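(* Let $n\ge 1$, $N>1$, $\alpha\in(0,1)$, let $p_0>0$ and $p_1^{\min},\dots,p_n^{\min}>0$ be fixed, and let $f:\mathbb{R}^n\times\mathbb{R}\to\mathbb{R}$, $(p^{\max},p_0)\mapsto f(p^{\max},p_0)$, be differentiable with respect to $p^{\max}$. With $\mathcal{P}_0$, $\mathbb{P}_N$ and $g_\alpha$ as defined in the context, let $p^{*,\max}\in\mathbb{R}^n$ be a (local) optimal solution of $$\min_{p^{\max}\in\mathcal{P}_0} f(p^{\max},p_0)\quad\text{s.t.}\quad \mathbb{P}_N(b\in M(p^{\max}))\ge\alpha .$$ Then there exists a multiplier $\mu^*\ge 0$ such that $$\nabla_{p^{\max}} f(p^{*,\max},p_0)+\mu^*\,\nabla g_\alpha(p^{*,\max})=0,\qquad g_\alpha(p^{*,\max})\le 0,\qquad \mu^*\,g_\alpha(p^{*,\max})=0,$$ i.e. $(p^{*,\max},\mu^* )\in\mathbb{R}^{n+1}$ is a Karush-Kuhn-Tucker point.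
   Context: **Sample pressures.** A gas network is a rooted directed tree with nodes $v_0,\dots,v_n$ (root $v_0$, edges oriented away from the root) and edges $e_1,\dots,e_n$. Its incidence matrix $A^+\in\mathbb{R}^{(n+1)\times n}$ has, in the column of an edge from $v_i$ to $v_j$, the entry $-1$ in the row of $v_i$, $+1$ in the row of $v_j$, and $0$ otherwise; $A\in\mathbb{R}^{n\times n}$ is $A^+$ without the row of $v_0$ (it is invertible). $\Phi\in\mathbb{R}^{n\times n}$ is a diagonal matrix with positive diagonal entries (friction constants of the edges). Put $g(b)=(A^\top)^{-1}\Phi\big((A^{-1}b)\circ|A^{-1}b|\big)$ (product and absolute value componentwise). For a load vector $b\in\mathbb{R}^n_{\ge0}$ the pressure at node $v_j$ is $p_j(b)=\sqrt{p_0^2-g_j(b)}$, $j=1,\dots,n$. Fix samples $b^{\mathcal{S},1},\dots,b^{\mathcal{S},N}\in\mathbb{R}^n_{\ge0}$ of the random load for which these pressures are well defined. Here $M(p^{\max})$ denotes the set of loads $b\in\mathbb{R}^n_{\ge0}$ for which $p_j(b)\in[p_j^{\min},p_j^{\max}]$ for all $j$. **Kernel density estimator.** Let $\sigma_{N,j}^2$ be the sample variance (assumed positive) of $p_j(b^{\mathcal{S},1}),\dots,p_j(b^{\mathcal{S},N})$, normalized by $1/(N-1)$, let $h_y=\left(\frac{4}{(n+2)N}\right)^{1/(n+4)}$ and $h_j=h_y\sigma_{N,j}>0$. Define $$\varrho_{p,N}(z)=\frac{1}{N\prod_{j=1}^n h_j}\sum_{i=1}^N\prod_{j=1}^n\frac{1}{\sqrt{2\pi}}\exp\left(-\frac12\left(\frac{z_j-p_j(b^{\mathcal{S},i})}{h_j}\right)^2\right),\qquad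 z\in\mathbb{R}^n.$$ **Approximated probability and constraint.** Let $\mathcal{P}_0=\prod_{i=1}^n[p_i^{\min},\infty)\subseteq\mathbb{R}^n$. For $p^{\max}\in\mathbb{R}^n$ let $$\mathbb{P}_N(b\in M(p^{\max})):=\int_{p_1^{\min}}^{p_1^{\max}}\cdots\int_{p_n^{\min}}^{p_n^{\max}}\varrho_{p,N}(z)\,dz_n\cdots dz_1=\frac{1}{N\,2^n}\sum_{i=1}^N\prod_{j=1}^n\left[\operatorname{erf}(\varphi_{i,j}(p_j^{\max}))-\operatorname{erf}(\varphi_{i,j}(p_j^{\min}))\right],$$ where $\varphi_{i,j}(x)=\frac{x-p_j(b^{\mathcal{S},i})}{\sqrt2\,h_j}$ and $\operatorname{erf}(x)=\frac{2}{\sqrt\pi}\int_0^x e^{-t^2}dt$. Finally $$g_\alpha:\mathbb{R}^n\to\mathbb{R},\qquad g_\alpha(p^{\max})=\alpha-\mathbb{P}_N(b\in M(p^{\max})).$$ (The constraint function $g_\alpha$ is not to be confused with the pressure loss function $g$.) *)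

theory Defs
  imports "HOL-Analysis.Analysis" "Graph_Theory.Arc_Walk"
begin

section \<open>Gas networks and sample pressures\<close>

text \<open>
  The nodes \<open>v\<^sub>1, \<dots>, v\<^sub>n\<close> and the edges \<open>e\<^sub>1, \<dots>, e\<^sub>n\<close> are both indexed by a finite type \<open>'n\<close>
  with \<open>n = CARD('n)\<close>. The node type is \<open>'n option\<close>: \<open>None\<close> is the root \<open>v\<^sub>0\<close> and \<open>Some j\<close> is \<open>v\<^sub>j\<close>.
  Since there is exactly one directed walk from the root to each node, the graph is a tree
  with all edges oriented away from the root.
\<close>

definition gas_network :: "('n option, 'n) pre_digraph \<Rightarrow> bool" where
  "gas_network G \<longleftrightarrow> verts G = UNIV \<and> arcs G = UNIV \<and>
     (\<forall>v. \<exists>!p. pre_digraph.awalk G None p v)"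

definition full_incidence :: "('n option, 'n) pre_digraph \<Rightarrow> real ^ 'n ^ 'n option" where
  "full_incidence G = (\<chi> v e. if v = tail G e then - 1 else if v = head G e then 1 else 0)"

definition incidence :: "('n option, 'n) pre_digraph \<Rightarrow> real ^ 'n ^ 'n" where
  "incidence G = (\<chi> j. full_incidence G $ Some j)"

definition positive_diagonal :: "real ^ 'n ^ 'n \<Rightarrow> bool" where
  "positive_diagonal \<Phi> \<longleftrightarrow> (\<forall>i j. i \<noteq> j \<longrightarrow> \<Phi> $ i $ j = 0) \<and> (\<forall>i. 0 < \<Phi> $ i $ i)"

definition pressure_loss ::
    "('n::finite option, 'n) pre_digraph \<Rightarrow> real ^ 'n ^ 'n \<Rightarrow> real ^ 'n \<Rightarrow> real ^ 'n" where
  "pressure_loss G \<Phi> b =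
     (let q = matrix_inv (incidence G) *v b
      in matrix_inv (transpose (incidence G)) *v (\<Phi> *v (\<chi> e. q $ e * \<bar>q $ e\<bar>)))"

definition pressure ::
    "('n::finite option, 'n) pre_digraph \<Rightarrow> real ^ 'n ^ 'n \<Rightarrow> real \<Rightarrow> real ^ 'n \<Rightarrow> real ^ 'n" where
  "pressure G \<Phi> p0 b = (\<chi> j. sqrt (p0\<^sup>2 - pressure_loss G \<Phi> b $ j))"

text \<open>Invertibility of the reduced incidence matrix, so that \<^const>\<open>matrix_inv\<close> is meaningful above.\<close>

lemma invertible_incidence:
  fixes G :: "('n::finite option, 'n) pre_digraph"
  assumes "gas_network G"
  shows "invertible (incidence G)"
proof -
  have "y = 0" if y: "transpose (incidence G) *v y = 0" for y :: "real ^ 'n"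
  proof -
    define Y where "Y v = (case v of None \<Rightarrow> 0 | Some j \<Rightarrow> y $ j)" for v
    have loop: "tail G e \<noteq> head G e" for e
    proof
      assume eq: "tail G e = head G e"
      obtain p where p: "pre_digraph.awalk G None p (tail G e)"
        and uniq: "\<And>q. pre_digraph.awalk G None q (tail G e) \<Longrightarrow> q = p"
        using assms unfolding gas_network_def by blast
      have "pre_digraph.cas G u p v \<Longrightarrow> v = tail G e \<Longrightarrow> pre_digraph.cas G u (p @ [e]) v" for u v
        by (induction p arbitrary: u) (auto simp: pre_digraph.cas.simps eq)
      then have "pre_digraph.awalk G None (p @ [e]) (tail G e)"
        using p assms by (auto simp: pre_digraph.awalk_def gas_network_def)
      from uniq[OF this] show False by simp
    qed
    have edge: "Y (tail G e) = Y (head G e)" for e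
    proof -
      have "0 = (transpose (incidence G) *v y) $ e" using y by simp
      also have "\<dots> = (\<Sum>j\<in>UNIV. full_incidence G $ Some j $ e * y $ j)"
        by (simp add: matrix_vector_mult_def transpose_def incidence_def)
      also have "\<dots> = (\<Sum>v\<in>range Some. full_incidence G $ v $ e * Y v)"
        by (subst sum.reindex) (auto simp: Y_def)
      also have "\<dots> = (\<Sum>v\<in>UNIV. full_incidence G $ v $ e * Y v)"
        by (rule sum.mono_neutral_left) (auto simp: Y_def split: option.splits)
      also have "\<dots> = (\<Sum>v\<in>UNIV. (if v = head G e then Y v else 0) - (if v = tail G e then Y v else 0))"
        using loop[of e] by (intro sum.cong) (auto simp: full_incidence_def)
      also have "\<dots> = Y (head G e) - Y (tail G e)"
        by (simp add: sum_subtractf)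
      finally show ?thesis by simp
    qed
    have walk: "pre_digraph.cas G u p v \<Longrightarrow> Y u = Y v" for u p v
      by (induction p arbitrary: u) (auto simp: pre_digraph.cas.simps edge)
    have "Y v = Y None" for v
    proof -
      obtain p where "pre_digraph.awalk G None p v"
        using assms unfolding gas_network_def by blast
      then show ?thesis using walk[of None p v] by (simp add: pre_digraph.awalk_def)
    qed
    from this[of "Some _"] show ?thesis by (simp add: Y_def vec_eq_iff)
  qed
  then obtain B where "B ** transpose (incidence G) = mat 1"
    using matrix_left_invertible_ker by blast
  then have "incidence G ** transpose B = mat 1"
    by (metis matrix_transpose_mul transpose_mat transpose_transpose)
  then show ?thesis
    using invertible_right_inverse by blast
qed

section \<open>Kernel density estimator\<close>

text \<open>Samples are indexed by \<open>1, \<dots>, N\<close>; below, \<open>P i\<close> is the pressure vector of sample \<open>i\<close>.\<close>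

definition sample_mean :: "nat \<Rightarrow> (nat \<Rightarrow> real) \<Rightarrow> real" where
  "sample_mean N x = (\<Sum>i=1..N. x i) / real N"

definition sample_variance :: "nat \<Rightarrow> (nat \<Rightarrow> real) \<Rightarrow> real" where
  "sample_variance N x = (\<Sum>i=1..N. (x i - sample_mean N x)\<^sup>2) / (real N - 1)"

definition bandwidth :: "nat \<Rightarrow> (nat \<Rightarrow> real ^ 'n) \<Rightarrow> 'n \<Rightarrow> real" where
  "bandwidth N P j =
     (4 / ((real CARD('n) + 2) * real N)) powr (1 / (real CARD('n) + 4))
       * sqrt (sample_variance N (\<lambda>i. P i $ j))"

definition kde :: "nat \<Rightarrow> (nat \<Rightarrow> real ^ 'n) \<Rightarrow> real ^ 'n \<Rightarrow> real" where
  "kde N P z =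
     1 / (real N * (\<Prod>j\<in>UNIV. bandwidth N P j)) *
     (\<Sum>i=1..N. \<Prod>j\<in>UNIV. 1 / sqrt (2 * pi) *
        exp (- (1 / 2) * ((z $ j - P i $ j) / bandwidth N P j)\<^sup>2))"

section \<open>Approximated probability and constraint function\<close>

text \<open>
  \<open>iterated_integral a b F js z\<close> integrates \<open>F\<close> over the coordinates in the list \<open>js\<close>, the head of
  the list being the outermost variable, with the remaining coordinates taken from \<open>z\<close>.
  The interval integrals are oriented, so \<open>b $ j < a $ j\<close> changes the sign.
\<close>

primrec iterated_integral ::
    "real ^ 'n \<Rightarrow> real ^ 'n \<Rightarrow> (real ^ 'n \<Rightarrow> real) \<Rightarrow> 'n list \<Rightarrow> real ^ 'n \<Rightarrow> real" where
  "iterated_integral a b F [] z = F z"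
| "iterated_integral a b F (j # js) z =
     (LBINT t = ereal (a $ j)..ereal (b $ j).
        iterated_integral a b F js (\<chi> k. if k = j then t else z $ k))"

text \<open>
  This is the approximation of the probability that the load lies in \<open>M(pmax)\<close>.
  The order on \<open>'n\<close> only fixes the order of integration (largest index innermost). All
  coordinates are integrated, so the start vector \<open>0\<close> is irrelevant.
\<close>

definition prob_N ::
    "nat \<Rightarrow> (nat \<Rightarrow> (real, 'n::{finite,linorder}) vec) \<Rightarrow> (real, 'n) vec \<Rightarrow> (real, 'n) vec \<Rightarrow> real" where
  "prob_N N P pmin pmax =
     iterated_integral pmin pmax (kde N P) (sorted_list_of_set UNIV) 0"

definition g_constraint ::
    "real \<Rightarrow> nat \<Rightarrow> (nat \<Rightarrow> (real, 'n::{finite,linorder}) vec) \<Rightarrow> (real, 'n) vec \<Rightarrow> (real, 'n) vec \<Rightarrow> real" where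
  "g_constraint \<alpha> N P pmin pmax = \<alpha> - prob_N N P pmin pmax"

definition P0_set :: "real ^ 'n \<Rightarrow> (real ^ 'n) set" where
  "P0_set pmin = {x. \<forall>j. pmin $ j \<le> x $ j}"

definition local_minimizer :: "('a::metric_space \<Rightarrow> real) \<Rightarrow> 'a set \<Rightarrow> 'a \<Rightarrow> bool" where
  "local_minimizer F S x \<longleftrightarrow> x \<in> S \<and> (\<exists>\<epsilon>>0. \<forall>y\<in>S. dist y x < \<epsilon> \<longrightarrow> F x \<le> F y)"

section \<open>Closed form of the approximated probability\<close>

definition erf :: "real \<Rightarrow> real" where
  "erf x = 2 / sqrt pi * (LBINT t = 0..ereal x. exp (- t\<^sup>2))"

lemma has_real_derivative_erf:
  "(erf has_real_derivative 2 / sqrt pi * exp (- x\<^sup>2)) (at x)"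
proof -
  define u where "u = \<bar>x\<bar> + 1"
  let ?h = "\<lambda>y. LBINT t=ereal (- u)..ereal y. exp (- t\<^sup>2)"
  have int: "interval_lebesgue_integrable lborel (ereal a) (ereal c) (\<lambda>t. exp (- t\<^sup>2) :: real)" for a c
    by (rule interval_integrable_isCont) (auto intro!: continuous_intros)
  have "(?h has_vector_derivative exp (- x\<^sup>2)) (at x within {- u..u})"
    by (rule interval_integral_FTC2[where a = "- u" and b = u])
      (auto simp: u_def intro!: continuous_intros)
  then have "(?h has_real_derivative exp (- x\<^sup>2)) (at x)"
    by (simp add: has_real_derivative_iff_has_vector_derivative at_within_Icc_at u_def)
  moreover have "(LBINT t=0..ereal y. exp (- t\<^sup>2)) = ?h y - ?h 0" for y
  proof -
    have "interval_lebesgue_integrable lborel (min (ereal (- u)) (min (ereal 0) (ereal y)))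
        (max (ereal (- u)) (max (ereal 0) (ereal y))) (\<lambda>t. exp (- t\<^sup>2) :: real)"
      using int by (simp flip: ereal_min ereal_max)
    from interval_integral_sum[OF this] show ?thesis by (simp add: zero_ereal_def)
  qed
  then have "erf = (\<lambda>y. 2 / sqrt pi * (?h y - ?h 0))"
    by (auto simp: erf_def)
  moreover have "((\<lambda>y. 2 / sqrt pi * (?h y - ?h 0)) has_real_derivative 2 / sqrt pi * (exp (- x\<^sup>2) - 0)) (at x)"
    using calculation(1) by (intro DERIV_cmult DERIV_diff DERIV_const)
  ultimately show ?thesis
    by simp
qed

lemma interval_integral_gaussian:
  fixes a b h m :: real
  assumes "0 < h"
  shows "(LBINT t=ereal a..ereal b. 1 / sqrt (2 * pi) * exp (- (1 / 2) * ((t - m) / h)\<^sup>2)) =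
    h / 2 * (erf ((b - m) / (sqrt 2 * h)) - erf ((a - m) / (sqrt 2 * h)))"
proof -
  let ?F = "\<lambda>t. h / 2 * erf ((t - m) / (sqrt 2 * h))"
  have "(?F has_real_derivative 1 / sqrt (2 * pi) * exp (- (1 / 2) * ((t - m) / h)\<^sup>2)) (at t)" for t
  proof -
    have "(?F has_real_derivative
        h / 2 * (2 / sqrt pi * exp (- ((t - m) / (sqrt 2 * h))\<^sup>2) * (1 / (sqrt 2 * h)))) (at t)"
      using assms
      by (intro DERIV_cmult DERIV_chain2[OF has_real_derivative_erf]) (auto intro!: derivative_eq_intros)
    moreover have "h / 2 * (2 / sqrt pi * exp (- ((t - m) / (sqrt 2 * h))\<^sup>2) * (1 / (sqrt 2 * h)))
        = 1 / sqrt (2 * pi) * exp (- (1 / 2) * ((t - m) / h)\<^sup>2)"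
      using assms by (simp add: real_sqrt_mult power_divide power_mult_distrib)
    ultimately show ?thesis by simp
  qed
  then have deriv: "(?F has_vector_derivative 1 / sqrt (2 * pi) * exp (- (1 / 2) * ((t - m) / h)\<^sup>2)) (at t within S)" for t S
    by (blast intro: has_vector_derivative_at_within has_real_derivative_iff_has_vector_derivative[THEN iffD1])
  have "continuous_on {min a b..max a b} (\<lambda>t. 1 / sqrt (2 * pi) * exp (- (1 / 2) * ((t - m) / h)\<^sup>2))"
    using assms by (intro continuous_intros) auto
  from interval_integral_FTC_finite[OF this deriv]
  show ?thesis by (simp add: right_diff_distrib)
qed

lemma iterated_integral_sum_prod:
  fixes a b z :: "real ^ 'n::finite" and k :: "nat \<Rightarrow> 'n \<Rightarrow> real \<Rightarrow> real"
  assumes "distinct js" and cont: "\<And>i j t. isCont (k i j) t" and "finite I"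
  shows "iterated_integral a b (\<lambda>z. \<Sum>i\<in>I. c i * (\<Prod>j\<in>UNIV. k i j (z $ j))) js z =
    (\<Sum>i\<in>I. c i * ((\<Prod>j\<in>set js. LBINT t=ereal (a $ j)..ereal (b $ j). k i j t) *
                    (\<Prod>j\<in>- set js. k i j (z $ j))))"
  using assms(1)
proof (induction js arbitrary: z)
  case Nil
  then show ?case by simp
next
  case (Cons l js)
  let ?J = "\<lambda>i j. LBINT t=ereal (a $ j)..ereal (b $ j). k i j t"
  define C where "C i = c i * ((\<Prod>j\<in>set js. ?J i j) * (\<Prod>j\<in>- set (l # js). k i j (z $ j)))" for i
  have split: "- set js = insert l (- set (l # js))" using Cons.prems by auto
  have int: "interval_lebesgue_integrable lborel (ereal (a $ l)) (ereal (b $ l)) (k i l)" for i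
    using cont by (intro interval_integrable_isCont)
  have step: "(\<Prod>j\<in>- set js. k i j ((\<chi> m. if m = l then t else z $ m) $ j))
      = k i l t * (\<Prod>j\<in>- set (l # js). k i j (z $ j))" for i t
  proof -
    have "(\<Prod>j\<in>- set js. k i j ((\<chi> m. if m = l then t else z $ m) $ j))
        = k i l t * (\<Prod>j\<in>- set (l # js). k i j ((\<chi> m. if m = l then t else z $ m) $ j))"
      by (subst split, subst prod.insert) auto
    also have "(\<Prod>j\<in>- set (l # js). k i j ((\<chi> m. if m = l then t else z $ m) $ j))
        = (\<Prod>j\<in>- set (l # js). k i j (z $ j))"
      by (rule prod.cong) auto
    finally show ?thesis .
  qed
  have "iterated_integral a b (\<lambda>z. \<Sum>i\<in>I. c i * (\<Prod>j\<in>UNIV. k i j (z $ j))) (l # js) z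
     = (LBINT t=ereal (a $ l)..ereal (b $ l). (\<Sum>i\<in>I. C i * k i l t))"
    using Cons.prems unfolding iterated_integral.simps
    by (subst Cons.IH) (simp_all only: step distinct.simps C_def mult_ac)
  also have "\<dots> = (\<Sum>i\<in>I. C i * ?J i l)"
    using \<open>finite I\<close>
  proof (induction I)
    case (insert i I)
    have "interval_lebesgue_integrable lborel (ereal (a $ l)) (ereal (b $ l)) (\<lambda>t. \<Sum>i\<in>I. C i * k i l t)"
      using cont by (intro interval_integrable_isCont) (auto intro!: continuous_intros)
    then show ?case using insert int by (simp add: interval_lebesgue_integral_add)
  qed simp
  also have "\<dots> = (\<Sum>i\<in>I. c i * ((\<Prod>j\<in>set (l # js). ?J i j) * (\<Prod>j\<in>- set (l # js). k i j (z $ j))))"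
    using Cons.prems by (intro sum.cong) (simp_all add: C_def mult_ac)
  finally show ?case .
qed

lemma prob_N_erf:
  fixes pmin pmax :: "real ^ 'n::{finite,linorder}"
  assumes h: "\<And>j. 0 < bandwidth N P j"
  defines "\<phi> \<equiv> \<lambda>i j x. (x - P i $ j) / (sqrt 2 * bandwidth N P j)"
  shows "prob_N N P pmin pmax =
    1 / (real N * 2 ^ CARD('n)) *
    (\<Sum>i=1..N. \<Prod>j\<in>UNIV. erf (\<phi> i j (pmax $ j)) - erf (\<phi> i j (pmin $ j)))"
proof -
  define H where "H = (\<Prod>j\<in>UNIV. bandwidth N P j)"
  have H: "H > 0" unfolding H_def using h by (intro prod_pos) auto
  let ?k = "\<lambda>i j t. 1 / sqrt (2 * pi) * exp (- (1 / 2) * ((t - P i $ j) / bandwidth N P j)\<^sup>2)"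
  let ?E = "\<lambda>i. \<Prod>j\<in>UNIV. erf (\<phi> i j (pmax $ j)) - erf (\<phi> i j (pmin $ j))"
  have kde: "kde N P = (\<lambda>z. \<Sum>i\<in>{1..N}. 1 / (real N * H) * (\<Prod>j\<in>UNIV. ?k i j (z $ j)))"
    unfolding kde_def H_def sum_distrib_left ..
  have cont: "isCont (?k i j) t" for i j t
    using h[of j] by (intro continuous_intros) auto
  have "prob_N N P pmin pmax = (\<Sum>i\<in>{1..N}. 1 / (real N * H) *
      (\<Prod>j\<in>UNIV. LBINT t=ereal (pmin $ j)..ereal (pmax $ j). ?k i j t))"
    unfolding prob_N_def kde
    by (subst iterated_integral_sum_prod[where k = ?k]) (use cont in simp_all)
  also have "\<dots> = (\<Sum>i\<in>{1..N}. 1 / (real N * H) * (H / 2 ^ CARD('n) * ?E i))"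
    by (simp only: interval_integral_gaussian[OF h] prod.distrib prod_dividef H_def \<phi>_def)
       (simp add: prod.distrib prod_dividef)
  also have "\<dots> = 1 / (real N * 2 ^ CARD('n)) * (\<Sum>i=1..N. ?E i)"
    using H unfolding sum_distrib_left by (intro sum.cong) auto
  finally show ?thesis .
qed

end

theory Submission
  imports Defs
begin

text \<open>
  The error function is strictly increasing, so a feasible point, where the approximated
  probability is at least \<open>\<alpha> > 0\<close>, cannot lie on the boundary of \<open>\<P>\<^sub>0\<close>: a coordinate with
  \<open>p\<^sub>j = p\<^sub>j\<^sup>m\<^sup>i\<^sup>n\<close> would make every product vanish. Hence only the probability constraint can be active,
  and its gradient is nonzero because the probability increases strictly in every coordinate
  there. For a single constraint with nonzero gradient the multiplier comes from projecting the
  gradient of the objective onto that of the constraint.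
\<close>

section \<open>One inequality constraint\<close>

text \<open>Riesz representation in coordinates: a linear functional on a Euclidean space is the
  inner product with the vector of its values on \<open>Basis\<close>. This turns Frechet
  derivatives into the gradients that the KKT condition speaks of.\<close>

lemma has_derivative_imp_GDERIV:
  fixes f :: "'a::euclidean_space \<Rightarrow> real"
  assumes "(f has_derivative D) (at x)"
  shows "GDERIV f x :> (\<Sum>i\<in>Basis. D i *\<^sub>R i)"
proof -
  have "D h = h \<bullet> (\<Sum>i\<in>Basis. D i *\<^sub>R i)" for h
  proof -
    have "D h = D (\<Sum>i\<in>Basis. (h \<bullet> i) *\<^sub>R i)"
      by (simp add: euclidean_representation)
    also have "\<dots> = (\<Sum>i\<in>Basis. (h \<bullet> i) * D i)"
      using has_derivative_linear[OF assms] by (simp add: linear_sum linear_cmul)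
    also have "\<dots> = h \<bullet> (\<Sum>i\<in>Basis. D i *\<^sub>R i)"
      by (simp add: inner_sum_right mult.commute)
    finally show ?thesis .
  qed
  then have "D = (\<lambda>h. h \<bullet> (\<Sum>i\<in>Basis. D i *\<^sub>R i))" by blast
  with assms show ?thesis unfolding gderiv_def by metis
qed

lemma GDERIV_directional:
  assumes "GDERIV f x :> D"
  shows "((\<lambda>t. f (x + t *\<^sub>R d)) has_real_derivative d \<bullet> D) (at 0)"
proof -
  have "((\<lambda>t. f (x + t *\<^sub>R d)) has_derivative (\<lambda>t. (t *\<^sub>R d) \<bullet> D)) (at 0)"
  proof (rule has_derivative_compose[where f = "\<lambda>t. x + t *\<^sub>R d"])
    show "((\<lambda>t. x + t *\<^sub>R d) has_derivative (\<lambda>t. t *\<^sub>R d)) (at 0)"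
      by (auto intro!: derivative_eq_intros)
    show "(f has_derivative (\<lambda>h. h \<bullet> D)) (at (x + 0 *\<^sub>R d))"
      using assms by (simp add: gderiv_def)
  qed
  then show ?thesis
    by (simp add: has_field_derivative_def mult_commute_abs)
qed

lemma GDERIV_eventually_less:
  assumes "GDERIV f x :> D" and "d \<bullet> D < 0"
  shows "eventually (\<lambda>t. f (x + t *\<^sub>R d) < f x) (at_right 0)"
proof -
  obtain e where "e > 0" "\<And>h. 0 < h \<Longrightarrow> h < e \<Longrightarrow> f (x + (0 + h) *\<^sub>R d) < f (x + 0 *\<^sub>R d)"
    using DERIV_neg_dec_right[OF GDERIV_directional[OF assms(1)] assms(2)] by blast
  then show ?thesis
    unfolding eventually_at_right_field by (intro exI[of _ e]) auto
qed

text \<open>Otherwise a short step along \<open>d\<close> would stay in \<open>S\<close>, since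
  \<open>x\<close> is interior, and would lower \<open>f\<close>. It would also stay feasible: by
  first-order decrease of \<open>g\<close> if the constraint is active, by mere continuity of
  \<open>g\<close> if it is not.\<close>

lemma local_minimizer_descent_direction:
  fixes f g :: "'a::real_inner \<Rightarrow> real"
  assumes min: "local_minimizer f {y \<in> S. g y \<le> 0} x"
    and int: "x \<in> interior S"
    and f: "GDERIV f x :> F" and g: "GDERIV g x :> D"
    and d: "g x = 0 \<Longrightarrow> d \<bullet> D < 0"
  shows "0 \<le> d \<bullet> F"
proof (rule ccontr)
  assume "\<not> 0 \<le> d \<bullet> F"
  then have 1: "eventually (\<lambda>t. f (x + t *\<^sub>R d) < f x) (at_right 0)"
    using GDERIV_eventually_less[OF f] by simp
  obtain e where e: "e > 0" "\<And>y. y \<in> S \<Longrightarrow> g y \<le> 0 \<Longrightarrow> dist y x < e \<Longrightarrow> f x \<le> f y"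
    and gx: "g x \<le> 0"
    using min by (auto simp: local_minimizer_def)
  have "((\<lambda>t. x + t *\<^sub>R d) \<longlongrightarrow> x + 0 *\<^sub>R d) (at_right 0)"
    by (intro tendsto_intros)
  then have lim: "((\<lambda>t. x + t *\<^sub>R d) \<longlongrightarrow> x) (at_right 0)" by simp
  have 2: "eventually (\<lambda>t. x + t *\<^sub>R d \<in> S) (at_right 0)"
    using topological_tendstoD[OF lim open_interior int]
    by eventually_elim (use interior_subset in blast)
  have 3: "eventually (\<lambda>t. dist (x + t *\<^sub>R d) x < e) (at_right 0)"
    by (rule tendstoD[OF lim e(1)])
  have 4: "eventually (\<lambda>t. g (x + t *\<^sub>R d) \<le> 0) (at_right 0)"
  proof (cases "g x = 0")
    case True
    then show ?thesis
      using GDERIV_eventually_less[OF g d] by (auto elim: eventually_mono)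
  next
    case False
    have "isCont g x"
      using g has_derivative_continuous unfolding gderiv_def by blast
    then have "((\<lambda>t. g (x + t *\<^sub>R d)) \<longlongrightarrow> g x) (at_right 0)"
      using lim by (rule isCont_tendsto_compose)
    then have "eventually (\<lambda>t. g (x + t *\<^sub>R d) < 0) (at_right 0)"
      using False gx by (intro order_tendstoD(2)) auto
    then show ?thesis by (auto elim: eventually_mono)
  qed
  \<comment> \<open>For small \<open>t > 0\<close> the point \<open>x + t *\<^sub>R d\<close> is
    feasible, close to \<open>x\<close> and better than \<open>x\<close>. As the filter
    \<open>at_right 0\<close> is nontrivial, this is absurd.\<close>
  have "eventually (\<lambda>t. False) (at_right (0::real))"
    using 1 2 3 4 by eventually_elim (use e(2) in force)
  then show False by simp
qed

lemma KKT_one_constraint: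
  fixes f g :: "'a::real_inner \<Rightarrow> real"
  assumes min: "local_minimizer f {y \<in> S. g y \<le> 0} x"
    and int: "x \<in> interior S"
    and f: "GDERIV f x :> F" and g: "GDERIV g x :> D"
    and D: "D \<noteq> 0"
  shows "\<exists>\<mu>\<ge>0. F + \<mu> *\<^sub>R D = 0 \<and> g x \<le> 0 \<and> \<mu> * g x = 0"
proof -
  note descent = local_minimizer_descent_direction[OF min int f g]
  have gx: "g x \<le> 0" using min by (auto simp: local_minimizer_def)
  show ?thesis
  proof (cases "g x = 0")
    case False
    \<comment> \<open>With an inactive constraint the condition on \<open>d\<close> is vacuous, so
      steepest descent is an admissible direction.\<close>
    then have "0 \<le> (- F) \<bullet> F" by (intro descent) simp
    then have "F = 0" using inner_gt_zero_iff[of F] by fastforce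
    then show ?thesis using gx by (intro exI[of _ 0]) simp
  next
    case True
    \<comment> \<open>Minus the coefficient of the orthogonal projection of \<open>F\<close> onto
      \<open>D\<close>, so that \<open>w\<close> is the part of \<open>F\<close> orthogonal to
      \<open>D\<close>. It remains to show that this part vanishes.\<close>
    define \<mu> where "\<mu> = - (D \<bullet> F) / (D \<bullet> D)"
    define w where "w = F + \<mu> *\<^sub>R D"
    have DD: "D \<bullet> D > 0" using D by simp
    \<comment> \<open>The direction \<open>- D\<close> strictly decreases \<open>g\<close>; that it
      cannot decrease \<open>f\<close> to first order fixes the sign of \<mu>.\<close>
    have "0 \<le> (- D) \<bullet> F" using D by (intro descent) simp
    then have "\<mu> \<ge> 0" unfolding \<mu>_def using DD by (intro divide_nonneg_pos) auto
    have wD: "w \<bullet> D = 0"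
      using D by (simp add: w_def \<mu>_def inner_diff_left inner_commute[of D F])
    \<comment> \<open>\<open>- w\<close> is only tangential to the constraint; tilting it by \<open>- e *\<^sub>R D\<close> makes it strictly feasible.\<close>
    have "w \<bullet> F \<le> 0 + e" if "e > 0" for e
    proof -
      \<comment> \<open>The tilt costs at most \<open>s * \<bar>D \<bullet> F\<bar>\<close>, which
        this choice bounds by \<open>e\<close>; the summand 1 keeps the denominator
        positive.\<close>
      define s where "s = e / (1 + \<bar>D \<bullet> F\<bar>)"
      have s: "s > 0" using that by (simp add: s_def add_pos_nonneg)
      have "0 \<le> (- w - s *\<^sub>R D) \<bullet> F"
        using wD DD s by (intro descent) (simp add: inner_diff_left)
      then have "w \<bullet> F \<le> s * - (D \<bullet> F)" by (simp add: inner_diff_left)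
      also have "\<dots> \<le> s * (1 + \<bar>D \<bullet> F\<bar>)"
        using s by (intro mult_left_mono) auto
      also have "\<dots> = e" unfolding s_def by (simp add: add_nonneg_eq_0_iff)
      finally show ?thesis by simp
    qed
    then have "w \<bullet> F \<le> 0" by (rule field_le_epsilon)
    moreover have "w \<bullet> w = w \<bullet> F"
      using wD by (simp add: w_def inner_add_right)
    ultimately have "w = 0" using inner_gt_zero_iff[of w] by fastforce
    then show ?thesis using \<open>\<mu> \<ge> 0\<close> True unfolding w_def by auto
  qed
qed

section \<open>The approximated probability\<close>

lemma erf_less: "erf x < erf y" if "x < y"
  by (rule DERIV_pos_imp_increasing[OF that]) (use has_real_derivative_erf in fastforce)

lemma bandwidth_pos:
  assumes "N > 0" and "sample_variance N (\<lambda>i. P i $ j) > 0"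
  shows "bandwidth N P j > 0"
  unfolding bandwidth_def using assms by (intro mult_pos_pos) (auto simp: add_pos_pos)

lemma P0_set_interiorI:
  fixes x :: "real ^ 'n"
  assumes "\<And>j. pmin $ j < x $ j"
  shows "x \<in> interior (P0_set pmin)"
proof (rule interiorI)
  show "open {y :: real ^ 'n. \<forall>j. pmin $ j < y $ j}"
    unfolding Collect_all_eq by (intro open_INT) (auto simp: open_halfspace_component_gt_cart)
qed (use assms in \<open>auto simp: P0_set_def less_imp_le\<close>)

lemma prob_N_pos_imp_less:
  fixes pmin x :: "real ^ 'n::{finite,linorder}"
  assumes h: "\<And>j. 0 < bandwidth N P j" and "x \<in> P0_set pmin" and "prob_N N P pmin x > 0"
  shows "pmin $ j < x $ j"
proof (rule ccontr)
  assume "\<not> pmin $ j < x $ j"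
  then have "x $ j = pmin $ j" using assms(2) by (auto simp: P0_set_def intro: antisym)
  then have "prob_N N P pmin x = 0"
    unfolding prob_N_erf[OF h] by (auto intro!: sum.neutral prod_zero bexI[of _ j] exI[of _ j])
  then show False using assms(3) by simp
qed

text \<open>By the product rule each partial derivative is a sum of products of positive factors.
  The all-ones direction adds up these partial derivatives and so witnesses that the derivative is
  nonzero.\<close>

lemma prob_N_has_derivative:
  fixes pmin x :: "real ^ 'n::{finite,linorder}"
  assumes h: "\<And>j. 0 < bandwidth N P j" and "N > 0" and less: "\<And>j. pmin $ j < x $ j"
  obtains D where "(prob_N N P pmin has_derivative D) (at x)" and "D (\<chi> j. 1) > 0"
proof -
  \<comment> \<open>Scaling by \<open>c j\<close> instead of dividing makes the inner derivative in
    the chain rule the constant \<open>c j\<close>.\<close>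
  define c where "c j = 1 / (sqrt 2 * bandwidth N P j)" for j
  define \<phi> where "\<phi> i j t = (t - P i $ j) * c j" for i j t
  define E where "E i j y = erf (\<phi> i j (y $ j)) - erf (\<phi> i j (pmin $ j))" for i j and y :: "(real, 'n) vec"
  define E' where "E' i j = 2 / sqrt pi * exp (- (\<phi> i j (x $ j))\<^sup>2) * c j" for i j
  define K where "K = 1 / (real N * 2 ^ CARD('n))"
  define D where "D v = K * (\<Sum>i=1..N. \<Sum>j\<in>UNIV. (v $ j * E' i j) * (\<Prod>k\<in>UNIV - {j}. E i k x))" for v
  have c: "c j > 0" for j using h by (simp add: c_def)
  have prob: "prob_N N P pmin = (\<lambda>y. K * (\<Sum>i=1..N. \<Prod>j\<in>UNIV. E i j y))"
    by (rule ext) (simp add: prob_N_erf[OF h] K_def E_def \<phi>_def c_def)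
  have "(E i j has_derivative (\<lambda>v. v $ j * E' i j)) (at x)" for i j
  proof -
    have "((\<lambda>t. erf (\<phi> i j t)) has_real_derivative E' i j) (at (x $ j))"
      unfolding E'_def
      by (rule DERIV_chain2[OF has_real_derivative_erf])
        (auto simp: \<phi>_def intro!: derivative_eq_intros)
    then have "((\<lambda>t. erf (\<phi> i j t)) has_derivative (\<lambda>s. E' i j * s)) (at (x $ j))"
      by (simp add: has_field_derivative_def)
    moreover have "((\<lambda>y. y $ j) has_derivative (\<lambda>v. v $ j)) (at x)"
      by (rule bounded_linear_imp_has_derivative[OF bounded_linear_vec_nth])
    ultimately have "((\<lambda>y. erf (\<phi> i j (y $ j))) has_derivative (\<lambda>v. E' i j * v $ j)) (at x)"
      using has_derivative_compose by blast
    from has_derivative_diff[OF this has_derivative_const]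
    show ?thesis unfolding E_def by (simp add: mult.commute)
  qed
  then have "(prob_N N P pmin has_derivative D) (at x)"
    unfolding prob D_def
    by (intro has_derivative_mult_right has_derivative_sum has_derivative_prod)
  moreover have "D (\<chi> j. 1) > 0"
  proof -
    have "E i j x > 0" for i j
      unfolding E_def \<phi>_def using less[of j] c[of j] by (simp add: erf_less)
    moreover have "E' i j > 0" for i j using c by (simp add: E'_def)
    ultimately show ?thesis
      unfolding D_def K_def using \<open>N > 0\<close>
      by (intro mult_pos_pos sum_pos prod_pos) auto
  qed
  ultimately show thesis by (rule that)
qed

theorem corollary7:
  fixes G :: "('n::{finite,linorder} option, 'n) pre_digraph"
    and \<Phi> :: "((real, 'n) vec, 'n) vec"
    and b :: "nat \<Rightarrow> (real, 'n) vec"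
    and P :: "nat \<Rightarrow> (real, 'n) vec"
    and N :: nat
    and \<alpha> p0 :: real
    and pmin pstar :: "(real, 'n) vec"
    and f :: "(real, 'n) vec \<times> real \<Rightarrow> real"
  assumes "gas_network G"
    and "positive_diagonal \<Phi>"
    and "N > 1"
    and "0 < \<alpha>" and "\<alpha> < 1"
    and "p0 > 0"
    and "\<forall>j. pmin $ j > 0"
    and "\<forall>i\<in>{1..N}. \<forall>j. b i $ j \<ge> 0"
    and "\<forall>i\<in>{1..N}. \<forall>j. pressure_loss G \<Phi> (b i) $ j \<le> p0\<^sup>2"
    and "P = (\<lambda>i. pressure G \<Phi> p0 (b i))"
    and "\<forall>j. sample_variance N (\<lambda>i. P i $ j) > 0"
    and "\<forall>q x. (\<lambda>y. f (y, q)) differentiable (at x)"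
    and "local_minimizer (\<lambda>x. f (x, p0))
           {x \<in> P0_set pmin. prob_N N P pmin x \<ge> \<alpha>} pstar"
  shows "\<exists>\<mu>\<ge>0. \<exists>grad_f grad_g.
           GDERIV (\<lambda>x. f (x, p0)) pstar :> grad_f \<and>
           GDERIV (g_constraint \<alpha> N P pmin) pstar :> grad_g \<and>
           grad_f + \<mu> *\<^sub>R grad_g = 0 \<and>
           g_constraint \<alpha> N P pmin pstar \<le> 0 \<and>
           \<mu> * g_constraint \<alpha> N P pmin pstar = 0"
proof -
  have h: "bandwidth N P j > 0" for j
    using assms by (intro bandwidth_pos) auto
  have min: "local_minimizer (\<lambda>x. f (x, p0)) {x \<in> P0_set pmin. g_constraint \<alpha> N P pmin x \<le> 0} pstar"
    using assms by (simp add: g_constraint_def)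
  then have "pstar \<in> P0_set pmin" and "prob_N N P pmin pstar > 0"
    using \<open>0 < \<alpha>\<close> by (auto simp: local_minimizer_def g_constraint_def)
  note less = prob_N_pos_imp_less[OF h this]
  have "N > 0" using \<open>N > 1\<close> by simp
  from prob_N_has_derivative[OF h this less]
  obtain D where D: "(prob_N N P pmin has_derivative D) (at pstar)" and pos: "D (\<chi> j. 1) > 0" .
  have g: "(g_constraint \<alpha> N P pmin has_derivative (\<lambda>v. - D v)) (at pstar)"
    using has_derivative_diff[OF has_derivative_const D] by (simp add: g_constraint_def[abs_def])
  from has_derivative_imp_GDERIV[OF this]
  obtain grad_g where grad_g: "GDERIV (g_constraint \<alpha> N P pmin) pstar :> grad_g" ..
  \<comment> \<open>The gradient was obtained without its formula; uniqueness of the derivative ties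
    it back to \<open>D\<close>, so positivity of \<open>D\<close> on the all-ones vector rules out
    a zero gradient.\<close>
  then have "(\<lambda>v. - D v) = (\<lambda>v. v \<bullet> grad_g)"
    using g unfolding gderiv_def by (blast intro: has_derivative_unique)
  then have "- D (\<chi> j. 1) = (\<chi> j. 1) \<bullet> grad_g" by (rule fun_cong)
  then have "grad_g \<noteq> 0" using pos by auto
  moreover obtain grad_f where grad_f: "GDERIV (\<lambda>x. f (x, p0)) pstar :> grad_f"
    using assms(12) has_derivative_imp_GDERIV unfolding differentiable_def by blast
  ultimately show ?thesis
    using KKT_one_constraint[OF min P0_set_interiorI[OF less] grad_f grad_g] grad_g by blast
qed

end
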